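(* Let $X$ be a compact metric space, let $\mu$ be a probability measure on the $\sigma$-algebra $\mathcal{B}$ of Borel subsets of $X$, and let $\mathcal{U}$ be a non-principal ultrafilter on $\mathbb{N}$. If $g: X \to \mathbb{R}$ is $\mu$-integrable and $(f_n)_{n\in\mathbb{N}}$ is a sequence of real-valued $\mu$-integrable functions on $X$ with $|f_n| \leq g$ for every $n \in \mathbb{N}$, then the map $$[x_n] \in \widehat{X} \;\mapsto\; \mathcal{U}\text{-}\lim_n f_n(x_n)$$ is $\widehat\mu_{\mathcal{U}}$-integrable and satisfies $$\int_{\widehat X} \mathcal{U}\text{-}\lim_n f_n(x_n)\, d\widehat\mu_{\mathcal{U}}([x_n]) = \mathcal{U}\text{-}\lim_n \int_X f_n(x)\, d\mu(x).$$
   Context: Ultralimits: a sequence $(a_n)$ in a compact Hausdorff space has $\mathcal{U}\text{-}\lim_n a_n=\ell$ if $\{n\in\mathbb{N} : a_n\in V\}\in\mathcal{U}$ for every neighbourhood $V$ of $\ell$; the limit exists and is unique. For real sequences the $\mathcal{U}$-limit is taken in $[-\infty,+\infty]$. Ultrapower: $\widehat X = X^{\mathbb{N}}/\sim$, where $(a_n)\sim(b_n)$ iff $\{n : a_n=b_n\}\in\mathcal{U}$; $[x_n]$ denotes the class of $(x_n)_{n\in\mathbb{N}}$. The value $\mathcal{U}\text{-}\lim_n f_n(x_n)$ does not depend on the representative of $[x_n]$. Ultrapower measure: for a sequence $(A_n)$ of subsets of $X$, the UP-set $\left(\prod_n A_n\right)/\sim$ is the set of all $[x_n]\in\widehat X$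 with $\{n : x_n\in A_n\}\in\mathcal{U}$. Let $\widehat{\mathcal{B}}$ be the algebra of UP-sets with all $A_n\in\mathcal{B}$, and define $\widehat\mu_{\mathcal{U}}\left(\left(\prod_n A_n\right)/\sim\right)=\mathcal{U}\text{-}\lim_n\mu(A_n)$ (well defined and finitely additive; it satisfies the countable additivity compatibility condition on $\widehat{\mathcal{B}}$). Its Carathéodory extension, still denoted $\widehat\mu_{\mathcal{U}}$, is a complete probability measure on a $\sigma$-algebra $L(\widehat{\mathcal{B}})\supset\widehat{\mathcal{B}}$ (the sets measurable for the outer measure induced by $\widehat\mu_{\mathcal{U}}$ on $\widehat{\mathcal{B}}$). Measurability and integrability on $\widehat X$ refer to $(L(\widehat{\mathcal{B}}),\widehat\mu_{\mathcal{U}})$. *)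

theory Defs
  imports "HOL-Probability.Probability"
begin

section \<open>Ultrafilters and ultralimits\<close>

text \<open>An ultrafilter is given as a value \<open>U\<close> of type \<open>nat filter\<close>; a set \<open>S\<close> belongs to it iff
  \<open>eventually (\<lambda>n. n \<in> S) U\<close>. The type also contains the improper filter \<open>bot\<close>. The \<open>U\<close>-limit of
  a sequence is then the library's \<open>Lim U\<close>.\<close>

definition ultrafilter :: "'a filter \<Rightarrow> bool" where
  "ultrafilter U \<longleftrightarrow> U \<noteq> bot \<and> (\<forall>P. eventually P U \<or> eventually (\<lambda>x. \<not> P x) U)"

definition nonprincipal_ultrafilter :: "'a filter \<Rightarrow> bool" where
  "nonprincipal_ultrafilter U \<longleftrightarrow> ultrafilter U \<and> (\<forall>x. U \<noteq> principal {x})"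

lemma ultrafilter_not_eventually:
  assumes "ultrafilter U"
  shows "\<not> eventually P U \<longleftrightarrow> eventually (\<lambda>x. \<not> P x) U"
proof
  assume "eventually (\<lambda>x. \<not> P x) U"
  moreover have "eventually (\<lambda>x. False) U" if "eventually P U" "eventually (\<lambda>x. \<not> P x) U"
    using that by eventually_elim simp
  ultimately show "\<not> eventually P U"
    using assms by (auto simp: ultrafilter_def trivial_limit_def)
qed (use assms in \<open>auto simp: ultrafilter_def\<close>)

lemma tendsto_Lim_ultrafilter:
  fixes f :: "'a \<Rightarrow> 'b::t2_space"
  assumes U: "ultrafilter U" and "compact (UNIV :: 'b set)"
  shows "(f \<longlongrightarrow> Lim U f) U"
proof -
  have "filtermap f U \<noteq> bot"
    using U by (simp add: ultrafilter_def filtermap_bot_iff)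
  then obtain l where l: "inf (nhds l) (filtermap f U) \<noteq> bot"
    using assms(2) unfolding compact_filter by auto
  have "(f \<longlongrightarrow> l) U"
  proof (rule topological_tendstoI, rule ccontr)
    fix V assume "open V" "l \<in> V" and n: "\<not> eventually (\<lambda>x. f x \<in> V) U"
    then have "eventually (\<lambda>y. y \<in> V) (nhds l)"
      by (simp add: eventually_nhds_in_open)
    moreover have "eventually (\<lambda>y. y \<notin> V) (filtermap f U)"
      using n by (simp add: ultrafilter_not_eventually[OF U] eventually_filtermap)
    ultimately have "eventually (\<lambda>_. False) (inf (nhds l) (filtermap f U))"
      unfolding eventually_inf by blast
    then show False
      using l by (simp add: trivial_limit_def)
  qed
  then show ?thesis
    using tendsto_Lim U by (metis ultrafilter_def)
qed

section \<open>The ultrapower\<close>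

definition up_rel :: "nat filter \<Rightarrow> 'a set \<Rightarrow> ((nat \<Rightarrow> 'a) \<times> (nat \<Rightarrow> 'a)) set" where
  "up_rel U X = {(a, b). a \<in> UNIV \<rightarrow> X \<and> b \<in> UNIV \<rightarrow> X \<and> eventually (\<lambda>n. a n = b n) U}"

definition ultrapower :: "nat filter \<Rightarrow> 'a set \<Rightarrow> (nat \<Rightarrow> 'a) set set" where
  "ultrapower U X = (UNIV \<rightarrow> X) // up_rel U X"

definition up_class :: "nat filter \<Rightarrow> 'a set \<Rightarrow> (nat \<Rightarrow> 'a) \<Rightarrow> (nat \<Rightarrow> 'a) set" where
  "up_class U X x = up_rel U X `` {x}"

definition up_set :: "nat filter \<Rightarrow> 'a set \<Rightarrow> (nat \<Rightarrow> 'a set) \<Rightarrow> (nat \<Rightarrow> 'a) set set" where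
  "up_set U X A = {up_class U X x | x. x \<in> UNIV \<rightarrow> X \<and> eventually (\<lambda>n. x n \<in> A n) U}"

text \<open>The map \<open>[x\<^sub>n] \<mapsto> U-lim f\<^sub>n(x\<^sub>n)\<close> on equivalence classes; all representatives give the same
  value.\<close>

definition up_lim :: "nat filter \<Rightarrow> (nat \<Rightarrow> 'a \<Rightarrow> real) \<Rightarrow> (nat \<Rightarrow> 'a) set \<Rightarrow> ereal" where
  "up_lim U f c = the_elem ((\<lambda>x. Lim U (\<lambda>n. ereal (f n (x n)))) ` c)"

lemma equiv_up_rel: "equiv (UNIV \<rightarrow> X) (up_rel U X)"
proof (rule equivI)
  show "sym (up_rel U X)"
    by (auto simp: sym_def up_rel_def eq_commute)
  show "trans (up_rel U X)"
  proof (rule transI)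
    fix a b c assume "(a, b) \<in> up_rel U X" "(b, c) \<in> up_rel U X"
    then have *: "eventually (\<lambda>n. a n = b n) U" "eventually (\<lambda>n. b n = c n) U"
        and "a \<in> UNIV \<rightarrow> X" "c \<in> UNIV \<rightarrow> X"
      by (simp_all add: up_rel_def)
    moreover from * have "eventually (\<lambda>n. a n = c n) U"
      by eventually_elim simp
    ultimately show "(a, c) \<in> up_rel U X"
      by (simp add: up_rel_def)
  qed
qed (auto simp: refl_on_def up_rel_def)

lemma Lim_cong_eventually:
  assumes "eventually (\<lambda>n. f n = g n) U"
  shows "Lim U f = Lim U g"
  unfolding t2_space_class.Lim_def using tendsto_cong[OF assms] by simp

lemma up_lim_class:
  assumes "x \<in> UNIV \<rightarrow> X"
  shows "up_lim U f (up_class U X x) = Lim U (\<lambda>n. ereal (f n (x n)))"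
proof -
  have "Lim U (\<lambda>n. ereal (f n (y n))) = Lim U (\<lambda>n. ereal (f n (x n)))"
    if "y \<in> up_class U X x" for y
  proof (rule Lim_cong_eventually)
    have "eventually (\<lambda>n. x n = y n) U"
      using that by (simp add: up_class_def up_rel_def)
    then show "eventually (\<lambda>n. ereal (f n (y n)) = ereal (f n (x n))) U"
      by eventually_elim simp
  qed
  moreover have "x \<in> up_class U X x"
    using assms by (simp add: up_class_def up_rel_def)
  ultimately have "(\<lambda>x. Lim U (\<lambda>n. ereal (f n (x n)))) ` up_class U X x
      = {Lim U (\<lambda>n. ereal (f n (x n)))}"
    by blast
  then show ?thesis
    by (simp add: up_lim_def)
qed

section \<open>The ultrapower measure\<close>

definition up_algebra :: "nat filter \<Rightarrow> 'a measure \<Rightarrow> (nat \<Rightarrow> 'a) set set set" where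
  "up_algebra U M = {up_set U (space M) A | A. \<forall>n. A n \<in> sets M}"

definition up_premeasure :: "nat filter \<Rightarrow> 'a measure \<Rightarrow> (nat \<Rightarrow> 'a) set set \<Rightarrow> ennreal" where
  "up_premeasure U M S = the_elem ((\<lambda>A. Lim U (\<lambda>n. emeasure M (A n))) `
     {A. (\<forall>n. A n \<in> sets M) \<and> up_set U (space M) A = S})"

text \<open>The Caratheodory extension, on the sets measurable for the induced outer measure.\<close>

definition ultrapower_measure :: "nat filter \<Rightarrow> 'a measure \<Rightarrow> (nat \<Rightarrow> 'a) set measure" where
  "ultrapower_measure U M =
     (let \<Omega> = ultrapower U (space M);
          \<mu> = outer_measure (up_algebra U M) (up_premeasure U M)
      in measure_of \<Omega> (lambda_system \<Omega> (Pow \<Omega>) \<mu>) \<mu>)"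

lemma up_class_in_up_set_iff:
  assumes "x \<in> UNIV \<rightarrow> X"
  shows "up_class U X x \<in> up_set U X A \<longleftrightarrow> eventually (\<lambda>n. x n \<in> A n) U"
proof
  assume "up_class U X x \<in> up_set U X A"
  then obtain y where y: "y \<in> UNIV \<rightarrow> X" "eventually (\<lambda>n. y n \<in> A n) U"
      "up_class U X x = up_class U X y"
    by (auto simp: up_set_def)
  then have "(x, y) \<in> up_rel U X"
    using eq_equiv_class[OF _ equiv_up_rel] by (metis up_class_def)
  then have "eventually (\<lambda>n. x n = y n) U"
    by (simp add: up_rel_def)
  with y(2) show "eventually (\<lambda>n. x n \<in> A n) U"
    by eventually_elim simp
qed (use assms in \<open>auto simp: up_set_def\<close>)

lemma up_set_subset_imp_eventually:
  assumes U: "ultrafilter U" and A: "\<And>n. A n \<subseteq> X" and X: "X \<noteq> {}"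
    and sub: "up_set U X A \<subseteq> up_set U X B"
  shows "eventually (\<lambda>n. A n \<subseteq> B n) U"
proof (rule ccontr)
  assume "\<not> ?thesis"
  then have ev: "eventually (\<lambda>n. \<not> A n \<subseteq> B n) U"
    by (simp add: ultrafilter_not_eventually[OF U])
  have "\<forall>n. \<exists>y. y \<in> X \<and> (\<not> A n \<subseteq> B n \<longrightarrow> y \<in> A n \<and> y \<notin> B n)"
    using A X by blast
  then obtain x where x: "\<And>n. x n \<in> X" "\<And>n. \<not> A n \<subseteq> B n \<Longrightarrow> x n \<in> A n \<and> x n \<notin> B n"
    by metis
  have xX: "x \<in> UNIV \<rightarrow> X"
    using x by auto
  from ev have "eventually (\<lambda>n. x n \<in> A n) U"
    by eventually_elim (simp add: x(2))
  then have "up_class U X x \<in> up_set U X B"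
    using sub up_class_in_up_set_iff[OF xX] by (meson subsetD)
  then have "eventually (\<lambda>n. x n \<in> B n) U"
    by (simp add: up_class_in_up_set_iff[OF xX])
  moreover from ev have "eventually (\<lambda>n. x n \<notin> B n) U"
    by eventually_elim (simp add: x(2))
  ultimately show False
    using ultrafilter_not_eventually[OF U, of "\<lambda>n. x n \<in> B n"] by simp
qed

lemma up_premeasure_up_set:
  assumes U: "ultrafilter U" and ne: "space M \<noteq> {}" and A: "\<And>n. A n \<in> sets M"
  shows "up_premeasure U M (up_set U (space M) A) = Lim U (\<lambda>n. emeasure M (A n))"
proof -
  let ?S = "{B. (\<forall>n. B n \<in> sets M) \<and> up_set U (space M) B = up_set U (space M) A}"
  have "Lim U (\<lambda>n. emeasure M (B n)) = Lim U (\<lambda>n. emeasure M (A n))" if "B \<in> ?S" for B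
  proof (rule Lim_cong_eventually)
    have sp: "A n \<subseteq> space M" "B n \<subseteq> space M" for n
      using that A sets.sets_into_space by auto
    have eq: "up_set U (space M) B = up_set U (space M) A"
      using that by simp
    have "eventually (\<lambda>n. A n \<subseteq> B n) U"
      by (rule up_set_subset_imp_eventually[OF U sp(1) ne]) (simp add: eq)
    moreover have "eventually (\<lambda>n. B n \<subseteq> A n) U"
      by (rule up_set_subset_imp_eventually[OF U sp(2) ne]) (simp add: eq)
    ultimately show "eventually (\<lambda>n. emeasure M (B n) = emeasure M (A n)) U"
      by eventually_elim (simp add: subset_antisym)
  qed
  moreover have "A \<in> ?S"
    using A by simp
  ultimately have "(\<lambda>A. Lim U (\<lambda>n. emeasure M (A n))) ` ?S = {Lim U (\<lambda>n. emeasure M (A n))}"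
    by blast
  then show ?thesis
    by (simp add: up_premeasure_def)
qed

section \<open>Integration of extended-real-valued functions\<close>

text \<open>The library's Bochner integral requires values in a Banach space, but an ultralimit may be
  infinite. Note that \<open>e2ennreal\<close> sends negative numbers to \<open>0\<close>, so \<open>e2ennreal (h x)\<close> and
  \<open>e2ennreal (- h x)\<close> are the positive and negative parts of \<open>h x\<close>.\<close>

definition ereal_integrable :: "'a measure \<Rightarrow> ('a \<Rightarrow> ereal) \<Rightarrow> bool" where
  "ereal_integrable M h \<longleftrightarrow> h \<in> borel_measurable M \<and> (\<integral>\<^sup>+x. e2ennreal \<bar>h x\<bar> \<partial>M) < \<infinity>"

definition ereal_integral :: "'a measure \<Rightarrow> ('a \<Rightarrow> ereal) \<Rightarrow> ereal" where
  "ereal_integral M h =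
     enn2ereal (\<integral>\<^sup>+x. e2ennreal (h x) \<partial>M) - enn2ereal (\<integral>\<^sup>+x. e2ennreal (- h x) \<partial>M)"

end

theory Submission
  imports Defs
begin

text \<open>For a step function built from superlevel sets of the \<open>f\<^sub>n\<close> with fixed levels, integral and
  ultralimit commute by the definition of the measure of a UP-set. Splitting into positive and
  negative parts, one may assume \<open>0 \<le> f\<^sub>n \<le> g\<close>. The staircase of mesh \<open>d\<close> and height \<open>t\<close> is at most
  \<open>f\<^sub>n\<close>, and \<open>f\<^sub>n\<close> exceeds it by at most \<open>d + (g - t)\<^sup>+\<close>, whose integral is small uniformly in
  \<open>n\<close> thanks to the domination. On the ultrapower the staircases approximate the truncations of
  the ultralimit from below, and monotone convergence removes the truncation.\<close>

section \<open>Ultrafilters and UP-sets\<close>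

text \<open>Order completeness takes the place of compactness: the supremum \<open>l\<close> of the
  U-eventual lower bounds of \<open>f\<close> is the limit. Below \<open>l\<close> some such bound
  intervenes; above \<open>l\<close> being a lower bound fails, and maximality of \<open>U\<close>
  turns this failure into \<open>f x < a\<close> eventually. This serves both \<open>ereal\<close>
  (values of functions) and \<open>ennreal\<close> (measures and integrals).\<close>

lemma tendsto_Lim_ultrafilter_linorder:
  fixes f :: "'a \<Rightarrow> 'b::{complete_linorder, linorder_topology}"
  assumes U: "ultrafilter U"
  shows "(f \<longlongrightarrow> Lim U f) U"
proof -
  define l where "l = Sup {a. eventually (\<lambda>x. a \<le> f x) U}"
  have "(f \<longlongrightarrow> l) U"
  proof (rule order_tendstoI)
    fix a assume "a < l"
    then obtain b where "a < b" "eventually (\<lambda>x. b \<le> f x) U"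
      unfolding l_def less_Sup_iff by auto
    then show "eventually (\<lambda>x. a < f x) U"
      by (auto elim: eventually_mono)
  next
    fix a assume "l < a"
    then have "\<not> eventually (\<lambda>x. a \<le> f x) U"
      unfolding l_def by (metis (mono_tags, lifting) Sup_upper leD mem_Collect_eq)
    then show "eventually (\<lambda>x. f x < a) U"
      by (simp add: ultrafilter_not_eventually[OF U] not_le)
  qed
  then show ?thesis
    using tendsto_Lim U by (metis ultrafilter_def)
qed

text \<open>If \<open>{k}\<close> belonged to \<open>U\<close>, the members of \<open>U\<close>
  would be exactly the sets containing \<open>k\<close>, making \<open>U\<close> principal.\<close>

lemma nonprincipal_ultrafilter_eventually_neq:
  assumes "nonprincipal_ultrafilter U"
  shows "eventually (\<lambda>x. x \<noteq> k) U"
proof (rule ccontr)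
  have U: "ultrafilter U" and ne: "U \<noteq> principal {k}"
    using assms by (auto simp: nonprincipal_ultrafilter_def)
  assume "\<not> ?thesis"
  then have k: "eventually (\<lambda>x. x = k) U"
    by (simp add: ultrafilter_not_eventually[OF U])
  have "eventually P U \<longleftrightarrow> P k" for P
  proof
    assume "eventually P U"
    with k have "eventually (\<lambda>x. P k) U"
      by eventually_elim simp
    then show "P k"
      using U by (auto simp: ultrafilter_def trivial_limit_def)
  next
    assume "P k"
    with k show "eventually P U"
      by (auto elim: eventually_mono)
  qed
  then have "U = principal {k}"
    by (simp add: filter_eq_iff eventually_principal)
  with ne show False ..
qed

text \<open>Removing the points below \<open>k\<close> one at a time stays inside \<open>U\<close>.
  In this form nonprincipality enters the saturation argument.\<close>

lemma nonprincipal_ultrafilter_eventually_ge: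
  fixes U :: "nat filter"
  assumes "nonprincipal_ultrafilter U"
  shows "eventually (\<lambda>n. k \<le> n) U"
proof (induction k)
  case (Suc k)
  then show ?case
    using nonprincipal_ultrafilter_eventually_neq[OF assms, of k] by eventually_elim auto
qed simp

section \<open>Boolean operations on UP-sets\<close>

lemma up_class_in_ultrapower: "x \<in> UNIV \<rightarrow> X \<Longrightarrow> up_class U X x \<in> ultrapower U X"
  unfolding ultrapower_def up_class_def by (rule quotientI)

lemma ultrapower_cases:
  assumes "c \<in> ultrapower U X"
  obtains x where "x \<in> UNIV \<rightarrow> X" "c = up_class U X x"
  using assms by (auto simp: ultrapower_def up_class_def quotient_def)

lemma up_set_subset_ultrapower: "up_set U X A \<subseteq> ultrapower U X"
  by (auto simp: up_set_def intro: up_class_in_ultrapower)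

text \<open>Every point of the ultrapower has a representative, so a set identity can be tested on
  classes, where membership in a UP-set becomes a statement about \<open>U\<close>.\<close>

lemma ultrapower_subset_eqI:
  assumes "S \<subseteq> ultrapower U X" "T \<subseteq> ultrapower U X"
    and "\<And>x. x \<in> UNIV \<rightarrow> X \<Longrightarrow> up_class U X x \<in> S \<longleftrightarrow> up_class U X x \<in> T"
  shows "S = T"
proof (rule set_eqI)
  fix c
  show "c \<in> S \<longleftrightarrow> c \<in> T"
  proof (cases "c \<in> ultrapower U X")
    case True
    then show ?thesis
      using assms(3) by (metis ultrapower_cases)
  qed (use assms in blast)
qed

lemma ultrapower_eq_up_set: "ultrapower U X = up_set U X (\<lambda>_. X)"
  by (rule ultrapower_subset_eqI[of _ U X])
    (simp_all add: up_class_in_up_set_iff up_class_in_ultrapower up_set_subset_ultrapower Pi_iff)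

lemma up_set_Int: "up_set U X A \<inter> up_set U X B = up_set U X (\<lambda>n. A n \<inter> B n)"
  by (rule ultrapower_subset_eqI[of _ U X])
    (simp_all add: up_class_in_up_set_iff eventually_conj_iff le_infI1 up_set_subset_ultrapower)

lemma up_set_Compl:
  fixes A :: "nat \<Rightarrow> 'a set"
  assumes "ultrafilter U"
  shows "ultrapower U X - up_set U X A = up_set U X (\<lambda>n. X - A n)"
proof (rule ultrapower_subset_eqI)
  fix x :: "nat \<Rightarrow> 'a" assume x: "x \<in> UNIV \<rightarrow> X"
  then have "x n \<in> X - A n \<longleftrightarrow> x n \<notin> A n" for n
    by auto
  with x show "up_class U X x \<in> ultrapower U X - up_set U X A \<longleftrightarrow>
      up_class U X x \<in> up_set U X (\<lambda>n. X - A n)"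
    by (simp add: up_class_in_up_set_iff up_class_in_ultrapower ultrafilter_not_eventually[OF assms])
qed (auto simp: up_set_subset_ultrapower)

lemma up_set_Un:
  fixes A B :: "nat \<Rightarrow> 'a set"
  assumes "ultrafilter U"
  shows "up_set U X A \<union> up_set U X B = up_set U X (\<lambda>n. A n \<union> B n)"
proof (rule ultrapower_subset_eqI)
  fix x :: "nat \<Rightarrow> 'a" assume x: "x \<in> UNIV \<rightarrow> X"
  \<comment> \<open>An ultrafilter is prime: when a disjunction holds U-eventually, one of its
    disjuncts does.\<close>
  have "eventually (\<lambda>n. x n \<in> A n) U \<or> eventually (\<lambda>n. x n \<in> B n) U"
    if AB: "eventually (\<lambda>n. x n \<in> A n \<union> B n) U"
  proof (rule disjCI)
    assume "\<not> eventually (\<lambda>n. x n \<in> B n) U"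
    then have "eventually (\<lambda>n. x n \<notin> B n) U"
      by (simp add: ultrafilter_not_eventually[OF assms])
    with AB show "eventually (\<lambda>n. x n \<in> A n) U"
      by eventually_elim simp
  qed
  then show "up_class U X x \<in> up_set U X A \<union> up_set U X B \<longleftrightarrow>
      up_class U X x \<in> up_set U X (\<lambda>n. A n \<union> B n)"
    using x by (auto simp: up_class_in_up_set_iff elim: eventually_mono)
qed (auto simp: up_set_subset_ultrapower)

text \<open>The forward direction compares \<open>A\<close> with the empty factors. It translates
  emptiness or disjointness in the ultrapower into the same property of U-almost all
  factors.\<close>

lemma up_set_eq_empty_iff:
  fixes A :: "nat \<Rightarrow> 'a set"
  assumes U: "ultrafilter U" and A: "\<And>n. A n \<subseteq> X" and X: "X \<noteq> {}"
  shows "up_set U X A = {} \<longleftrightarrow> eventually (\<lambda>n. A n = {}) U"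
proof
  assume "up_set U X A = {}"
  then show "eventually (\<lambda>n. A n = {}) U"
    using up_set_subset_imp_eventually[OF U A X, where B = "\<lambda>_. {}"] by simp
next
  assume e: "eventually (\<lambda>n. A n = {}) U"
  show "up_set U X A = {}"
  proof (rule ultrapower_subset_eqI)
    fix x :: "nat \<Rightarrow> 'a" assume x: "x \<in> UNIV \<rightarrow> X"
    from e have "eventually (\<lambda>n. x n \<notin> A n) U"
      by eventually_elim simp
    then show "up_class U X x \<in> up_set U X A \<longleftrightarrow> up_class U X x \<in> {}"
      using x by (simp add: up_class_in_up_set_iff flip: ultrafilter_not_eventually[OF U])
  qed (auto simp: up_set_subset_ultrapower)
qed

text \<open>Countable saturation: nonprincipality lets the diagonal sequence pick, at index \<open>n\<close>, a point
  of the longest nonempty intersection among the first \<open>n\<close> ones.\<close>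

lemma up_set_decreasing_Inter_nonempty:
  assumes U: "nonprincipal_ultrafilter U" and A: "\<And>i n. A i n \<subseteq> X" and X: "X \<noteq> {}"
    and dec: "decseq (\<lambda>i. up_set U X (A i))" and ne: "\<And>i. up_set U X (A i) \<noteq> {}"
  shows "(\<Inter>i. up_set U X (A i)) \<noteq> {}"
proof -
  have uf: "ultrafilter U"
    using U by (simp add: nonprincipal_ultrafilter_def)
  \<comment> \<open>Finite intersections make the factors decrease in \<open>i\<close> at every
    index \<open>n\<close>. The UP-sets do not change, since they were decreasing already.\<close>
  define B where "B i n = (\<Inter>j\<le>i. A j n)" for i n
  have B_Suc: "B (Suc i) n = B i n \<inter> A (Suc i) n" for i n
    by (auto simp: B_def atMost_Suc)
  have B_eq: "up_set U X (B i) = up_set U X (A i)" for i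
  proof (induction i)
    case 0
    then show ?case
      by (simp add: B_def)
  next
    case (Suc i)
    have "up_set U X (B (Suc i)) = up_set U X (B i) \<inter> up_set U X (A (Suc i))"
      unfolding up_set_Int B_Suc ..
    also have "\<dots> = up_set U X (A (Suc i))"
      using Suc decseq_SucD[OF dec, of i] by auto
    finally show ?case .
  qed
  have BX: "B i n \<subseteq> X" for i n
    using A by (auto simp: B_def)
  have B_ne: "eventually (\<lambda>n. B i n \<noteq> {}) U" for i
    using ne[of i] up_set_eq_empty_iff[OF uf, where A = "B i", OF BX X]
    by (simp add: B_eq ultrafilter_not_eventually[OF uf])
  have "\<exists>y. y \<in> X \<and> (\<forall>i\<le>n. B i n \<noteq> {} \<longrightarrow> y \<in> B i n)" for n
  proof (cases "\<exists>i\<le>n. B i n \<noteq> {}")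
    case True
    define k where "k = (GREATEST i. i \<le> n \<and> B i n \<noteq> {})"
    have k: "k \<le> n \<and> B k n \<noteq> {}"
      unfolding k_def using True
      by (rule GreatestI_ex_nat[where P="\<lambda>i. i \<le> n \<and> B i n \<noteq> {}" and b=n]) auto
    have le: "i \<le> k" if "i \<le> n" "B i n \<noteq> {}" for i
      unfolding k_def
      by (rule Greatest_le_nat[where P="\<lambda>i. i \<le> n \<and> B i n \<noteq> {}" and b=n]) (use that in auto)
    obtain y where y: "y \<in> B k n"
      using k by auto
    have "y \<in> B i n" if "i \<le> n" "B i n \<noteq> {}" for i
      using y le[OF that] by (simp add: B_def)
    with y BX show ?thesis
      by blast
  qed (use X in auto)
  then obtain x where x: "\<And>n. x n \<in> X" "\<And>n i. i \<le> n \<Longrightarrow> B i n \<noteq> {} \<Longrightarrow> x n \<in> B i n"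
    by metis
  have xX: "x \<in> UNIV \<rightarrow> X"
    using x by auto
  \<comment> \<open>For fixed \<open>i\<close>, U-almost every \<open>n\<close> satisfies both
    conditions in the choice of \<open>x n\<close>: the factor is nonempty and \<open>n\<close> has
    reached \<open>i\<close>.\<close>
  have "eventually (\<lambda>n. x n \<in> B i n) U" for i
    using B_ne[of i] nonprincipal_ultrafilter_eventually_ge[OF U, of i]
    by eventually_elim (rule x(2))
  then have "up_class U X x \<in> up_set U X (A i)" for i
    by (simp add: up_class_in_up_set_iff[OF xX] flip: B_eq)
  then show ?thesis
    by blast
qed

section \<open>The Caratheodory extension\<close>

locale ultrapower_prob_space = prob_space M for M :: "'a measure" +
  fixes U :: "nat filter"
  assumes nonprincipal: "nonprincipal_ultrafilter U"
begin

lemma ultrafilter: "ultrafilter U"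
  using nonprincipal by (simp add: nonprincipal_ultrafilter_def)

lemma U_neq_bot: "U \<noteq> bot"
  using ultrafilter by (simp add: ultrafilter_def)

section \<open>The premeasure on UP-sets and its countable additivity\<close>

lemma up_premeasure_tendsto:
  assumes "\<And>n. A n \<in> events"
  shows "((\<lambda>n. emeasure M (A n)) \<longlongrightarrow> up_premeasure U M (up_set U (space M) A)) U"
  unfolding up_premeasure_up_set[OF ultrafilter not_empty assms]
  by (rule tendsto_Lim_ultrafilter_linorder[OF ultrafilter])

lemma up_set_in_up_algebra: "(\<And>n. A n \<in> events) \<Longrightarrow> up_set U (space M) A \<in> up_algebra U M"
  unfolding up_algebra_def by (rule CollectI, rule exI[of _ A]) simp

lemma up_algebra_cases:
  assumes "S \<in> up_algebra U M"
  obtains A where "S = up_set U (space M) A" "\<forall>n. A n \<in> events"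
  using assms unfolding up_algebra_def by (elim CollectE exE conjE)

lemma algebra_up_algebra: "algebra (ultrapower U (space M)) (up_algebra U M)"
  unfolding algebra_iff_Un
proof (intro conjI ballI)
  show "up_algebra U M \<subseteq> Pow (ultrapower U (space M))"
  proof (rule subsetI)
    fix S assume "S \<in> up_algebra U M"
    then obtain A where "S = up_set U (space M) A"
      by (rule up_algebra_cases)
    then show "S \<in> Pow (ultrapower U (space M))"
      by (simp add: up_set_subset_ultrapower)
  qed
  have "up_set U (space M) (\<lambda>_. {}) = {}"
    by (simp add: up_set_eq_empty_iff[OF ultrafilter _ not_empty])
  then show "{} \<in> up_algebra U M"
    using up_set_in_up_algebra[of "\<lambda>_. {}"] by simp
next
  fix S assume "S \<in> up_algebra U M"
  then obtain A where "S = up_set U (space M) A" "\<forall>n. A n \<in> events"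
    by (rule up_algebra_cases)
  then show "ultrapower U (space M) - S \<in> up_algebra U M"
    by (simp add: up_set_Compl[OF ultrafilter] up_set_in_up_algebra sets.compl_sets)
next
  fix S T assume S: "S \<in> up_algebra U M" and T: "T \<in> up_algebra U M"
  obtain A where "S = up_set U (space M) A" "\<forall>n. A n \<in> events"
    using S by (rule up_algebra_cases)
  moreover obtain B where "T = up_set U (space M) B" "\<forall>n. B n \<in> events"
    using T by (rule up_algebra_cases)
  ultimately show "S \<union> T \<in> up_algebra U M"
    by (simp add: up_set_Un[OF ultrafilter] up_set_in_up_algebra sets.Un)
qed

lemma up_premeasure_empty: "up_premeasure U M {} = 0"
proof -
  have "up_set U (space M) (\<lambda>_. {}) = {}"
    by (simp add: up_set_eq_empty_iff[OF ultrafilter _ not_empty])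
  then have "((\<lambda>n. 0 :: ennreal) \<longlongrightarrow> up_premeasure U M {}) U"
    using up_premeasure_tendsto[of "\<lambda>_. {}"] by simp
  then show ?thesis
    using tendsto_unique[OF U_neq_bot] tendsto_const by blast
qed

text \<open>Disjoint UP-sets have disjoint factors for U-almost all \<open>n\<close>, so additivity
  of \<open>M\<close> holds eventually and passes to the limit.\<close>

lemma additive_up_premeasure: "additive (up_algebra U M) (up_premeasure U M)"
  unfolding additive_def
proof (intro ballI impI)
  fix S T assume ST: "S \<in> up_algebra U M" "T \<in> up_algebra U M" and disj: "S \<inter> T = {}"
  obtain A where S: "S = up_set U (space M) A" and A: "\<forall>n. A n \<in> events"
    using ST(1) by (rule up_algebra_cases)
  note A = A[rule_format]
  obtain B where T: "T = up_set U (space M) B" and B: "\<forall>n. B n \<in> events"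
    using ST(2) by (rule up_algebra_cases)
  note B = B[rule_format]
  have "A n \<inter> B n \<subseteq> space M" for n
    using sets.sets_into_space[OF A] by blast
  then have "eventually (\<lambda>n. A n \<inter> B n = {}) U"
    using disj unfolding S T up_set_Int by (simp add: up_set_eq_empty_iff[OF ultrafilter _ not_empty])
  then have "eventually (\<lambda>n. emeasure M (A n) + emeasure M (B n) = emeasure M (A n \<union> B n)) U"
    by eventually_elim (simp add: A B plus_emeasure)
  moreover have "((\<lambda>n. emeasure M (A n) + emeasure M (B n)) \<longlongrightarrow>
      up_premeasure U M S + up_premeasure U M T) U"
    unfolding S T by (intro tendsto_add up_premeasure_tendsto A B)
  ultimately have "((\<lambda>n. emeasure M (A n \<union> B n)) \<longlongrightarrow>
      up_premeasure U M S + up_premeasure U M T) U"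
    by (rule Lim_transform_eventually[rotated])
  moreover have "((\<lambda>n. emeasure M (A n \<union> B n)) \<longlongrightarrow> up_premeasure U M (S \<union> T)) U"
    unfolding S T up_set_Un[OF ultrafilter] by (rule up_premeasure_tendsto) (intro sets.Un A B)
  ultimately show "up_premeasure U M (S \<union> T) = up_premeasure U M S + up_premeasure U M T"
    using tendsto_unique[OF U_neq_bot] by blast
qed

text \<open>For a finite additive set function, continuity at the empty set suffices. By saturation,
  a decreasing sequence of UP-sets with empty intersection is already empty from some index on, so
  its premeasures are eventually 0.\<close>

lemma countably_additive_up_premeasure: "countably_additive (up_algebra U M) (up_premeasure U M)"
proof -
  interpret alg: algebra "ultrapower U (space M)" "up_algebra U M"
    by (rule algebra_up_algebra)
  show ?thesis
  proof (rule alg.empty_continuous_imp_countably_additive)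
    show "positive (up_algebra U M) (up_premeasure U M)"
      by (simp add: positive_def up_premeasure_empty)
    show "additive (up_algebra U M) (up_premeasure U M)"
      by (rule additive_up_premeasure)
    show "\<forall>S\<in>up_algebra U M. up_premeasure U M S \<noteq> \<infinity>"
    proof
      fix S assume "S \<in> up_algebra U M"
      then obtain A where S: "S = up_set U (space M) A" and A: "\<forall>n. A n \<in> events"
        by (rule up_algebra_cases)
      note A = A[rule_format]
      have "up_premeasure U M S \<le> 1"
        unfolding S by (rule tendsto_upperbound[OF up_premeasure_tendsto[OF A] always_eventually U_neq_bot])
          (simp add: emeasure_le_1)
      then show "up_premeasure U M S \<noteq> \<infinity>"
        by (auto simp: top_unique)
    qed
  next
    fix S :: "nat \<Rightarrow> (nat \<Rightarrow> 'a) set set"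
    assume "range S \<subseteq> up_algebra U M" and dec: "decseq S" and Int: "(\<Inter>i. S i) = {}"
    then have "\<forall>i. \<exists>A. S i = up_set U (space M) A \<and> (\<forall>n. A n \<in> events)"
      by (auto simp: up_algebra_def image_subset_iff)
    then obtain A where S: "S = (\<lambda>i. up_set U (space M) (A i))" and A: "\<And>i n. A i n \<in> events"
      by metis
    have "\<exists>k. S k = {}"
    proof (rule ccontr)
      assume "\<nexists>k. S k = {}"
      then have "(\<Inter>i. up_set U (space M) (A i)) \<noteq> {}"
        using dec unfolding S
        by (intro up_set_decreasing_Inter_nonempty[OF nonprincipal sets.sets_into_space[OF A] not_empty])
          simp_all
      with Int show False
        by (simp add: S)
    qed
    then obtain k where k: "S k = {}" ..
    have "S i = {}" if "k \<le> i" for i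
      using decseqD[OF dec that] k by simp
    then have "eventually (\<lambda>i. up_premeasure U M (S i) = 0) sequentially"
      by (intro eventually_sequentiallyI[of k]) (simp add: up_premeasure_empty)
    then show "(\<lambda>i. up_premeasure U M (S i)) \<longlonglongrightarrow> 0"
      by (rule tendsto_eventually)
  qed
qed

section \<open>Existence of the extension and agreement with the premeasure\<close>

lemma
  shows space_ultrapower_measure: "space (ultrapower_measure U M) = ultrapower U (space M)"
    and sets_ultrapower_measure_up_set:
      "(\<And>n. A n \<in> events) \<Longrightarrow> up_set U (space M) A \<in> sets (ultrapower_measure U M)"
    and emeasure_ultrapower_measure_up_set:
      "(\<And>n. A n \<in> events) \<Longrightarrow>
        emeasure (ultrapower_measure U M) (up_set U (space M) A) = up_premeasure U M (up_set U (space M) A)"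
proof -
  define \<Omega> where "\<Omega> = ultrapower U (space M)"
  define \<mu> where "\<mu> = outer_measure (up_algebra U M) (up_premeasure U M)"
  define L where "L = lambda_system \<Omega> (Pow \<Omega>) \<mu>"
  have N: "ultrapower_measure U M = measure_of \<Omega> L \<mu>"
    by (simp add: ultrapower_measure_def \<Omega>_def \<mu>_def L_def Let_def)
  interpret alg: algebra \<Omega> "up_algebra U M"
    unfolding \<Omega>_def by (rule algebra_up_algebra)
  have pos: "positive (up_algebra U M) (up_premeasure U M)"
    by (simp add: positive_def up_premeasure_empty)
  have inc: "increasing (up_algebra U M) (up_premeasure U M)"
    by (rule alg.additive_increasing[OF pos additive_up_premeasure])
  \<comment> \<open>Caratheodory's lemma: the outer measure is a measure on its measurable sets.
    This is what makes \<open>measure_of\<close> return the intended space and not a degenerate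
    one.\<close>
  have ms: "measure_space \<Omega> L \<mu>"
    unfolding L_def \<mu>_def
    by (rule sigma_algebra.caratheodory_lemma[OF sigma_algebra_Pow])
      (rule alg.outer_measure_space_outer_measure[OF pos inc])
  then have sa: "sigma_algebra \<Omega> L"
    by (simp add: measure_space_def)
  have sub: "up_algebra U M \<subseteq> L"
    unfolding L_def \<mu>_def by (rule alg.algebra_subset_lambda_system[OF pos inc additive_up_premeasure])
  have LP: "L \<subseteq> Pow \<Omega>"
    by (auto simp: L_def dest: lambda_system_sets)
  show "space (ultrapower_measure U M) = ultrapower U (space M)"
    unfolding \<Omega>_def[symmetric] by (simp add: N space_measure_of[OF LP])
  \<comment> \<open>\<open>measure_of\<close> passes to the generated sigma-algebra;
    \<open>L\<close> is one already, so no sets are added.\<close>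
  have sets: "sets (ultrapower_measure U M) = L"
    by (simp add: N sets_measure_of[OF LP] sigma_algebra.sigma_sets_eq[OF sa])
  assume "\<And>n. A n \<in> events"
  then have A: "up_set U (space M) A \<in> up_algebra U M"
    by (rule up_set_in_up_algebra)
  with sub show S: "up_set U (space M) A \<in> sets (ultrapower_measure U M)"
    by (auto simp: sets)
  have "emeasure (ultrapower_measure U M) (up_set U (space M) A) = \<mu> (up_set U (space M) A)"
    using ms A sub by (intro emeasure_measure_of[OF N LP])
      (auto simp: measure_space_def sets)
  \<comment> \<open>Countable additivity on the algebra is used here: it prevents a countable cover
    by UP-sets from lowering the outer measure below the premeasure.\<close>
  then show "emeasure (ultrapower_measure U M) (up_set U (space M) A) = up_premeasure U M (up_set U (space M) A)"
    by (simp add: \<mu>_def alg.outer_measure_agrees[OF pos countably_additive_up_premeasure A])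
qed

lemma emeasure_up_set_tendsto:
  assumes "\<And>n. A n \<in> events"
  shows "((\<lambda>n. emeasure M (A n)) \<longlongrightarrow> emeasure (ultrapower_measure U M) (up_set U (space M) A)) U"
  unfolding emeasure_ultrapower_measure_up_set[OF assms] by (rule up_premeasure_tendsto[OF assms])

text \<open>The whole ultrapower is the UP-set with all factors \<open>space M\<close>, so its mass
  is the limit of the constant 1.\<close>

lemma prob_space_ultrapower_measure: "prob_space (ultrapower_measure U M)"
proof (rule prob_spaceI)
  have "((\<lambda>n. emeasure M (space M)) \<longlongrightarrow>
      emeasure (ultrapower_measure U M) (up_set U (space M) (\<lambda>_. space M))) U"
    by (rule emeasure_up_set_tendsto) simp
  then have "((\<lambda>n. 1) \<longlongrightarrow> emeasure (ultrapower_measure U M) (space (ultrapower_measure U M))) U"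
    by (simp add: emeasure_space_1 space_ultrapower_measure ultrapower_eq_up_set)
  then show "emeasure (ultrapower_measure U M) (space (ultrapower_measure U M)) = 1"
    by (rule tendsto_unique[OF U_neq_bot _ tendsto_const])
qed

end

section \<open>Integration of ultralimits\<close>

text \<open>For \<open>d > 0\<close> and \<open>a \<ge> 0\<close> this rounds \<open>a\<close> down
  to a multiple of \<open>d\<close>, capped at \<open>k * d\<close>. Writing it as a sum over levels
  makes each summand a multiple of the indicator of a superlevel set; starting at level
  \<open>Suc 0\<close> keeps the value at most \<open>a\<close>.\<close>

definition staircase :: "real \<Rightarrow> nat \<Rightarrow> real \<Rightarrow> real" where
  "staircase d k a = (\<Sum>j<k. if real (Suc j) * d \<le> a then d else 0)"

lemma staircase_approx:
  assumes "0 \<le> d" "0 \<le> a"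
  shows "staircase d k a \<le> a" "min a (real k * d) \<le> staircase d k a + d"
proof -
  \<comment> \<open>The bounds alone are not inductive. The invariant separates the saturated case,
    where the cap is attained exactly, from the case below the cap, where the rounding error is at
    most \<open>d\<close>.\<close>
  have "staircase d k a \<le> a \<and> (real k * d \<le> a \<longrightarrow> staircase d k a = real k * d)
      \<and> (a < real k * d \<longrightarrow> a \<le> staircase d k a + d)"
  proof (induction k)
    case (Suc k)
    have "real k * d \<le> real (Suc k) * d"
      using assms by (simp add: mult_right_mono)
    moreover have "real (Suc k) * d = real k * d + d"
      by (simp add: algebra_simps)
    moreover have "staircase d (Suc k) a = staircase d k a + (if real (Suc k) * d \<le> a then d else 0)"
      by (simp add: staircase_def)
    ultimately show ?case
      using Suc assms by (smt (verit))
  qed (use assms in \<open>auto simp: staircase_def\<close>)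
  then show "staircase d k a \<le> a" "min a (real k * d) \<le> staircase d k a + d"
    using assms by auto
qed

context ultrapower_prob_space
begin

section \<open>Measurability of the ultralimit\<close>

lemma up_lim_tendsto:
  assumes "x \<in> UNIV \<rightarrow> space M"
  shows "((\<lambda>n. ereal (f n (x n))) \<longlongrightarrow> up_lim U f (up_class U (space M) x)) U"
  unfolding up_lim_class[OF assms] by (rule tendsto_Lim_ultrafilter_linorder[OF ultrafilter])

text \<open>The superlevel set at \<open>a\<close> is a countable union of UP-sets: the ultralimit
  exceeds \<open>a\<close> exactly when, for some rational \<open>r\<close> above \<open>a\<close>,
  U-almost all \<open>f n (x n)\<close> exceed \<open>r\<close>.\<close>

lemma up_lim_measurable:
  assumes f: "\<And>n. f n \<in> borel_measurable M"
  shows "up_lim U f \<in> borel_measurable (ultrapower_measure U M)"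
  unfolding borel_measurable_ereal_iff_Ioi
proof
  fix a :: ereal
  define T where "T r = up_set U (space M) (\<lambda>n. {x \<in> space M. real_of_rat r < f n x})" for r
  have T: "T r \<in> sets (ultrapower_measure U M)" for r
    unfolding T_def by (rule sets_ultrapower_measure_up_set) (use f in measurable)
  have "up_lim U f -` {a<..} \<inter> space (ultrapower_measure U M)
      = (\<Union>r\<in>{r. a < ereal (real_of_rat r)}. T r)"
  proof (rule ultrapower_subset_eqI)
    show "up_lim U f -` {a<..} \<inter> space (ultrapower_measure U M) \<subseteq> ultrapower U (space M)"
      by (simp add: space_ultrapower_measure)
    show "(\<Union>r\<in>{r. a < ereal (real_of_rat r)}. T r) \<subseteq> ultrapower U (space M)"
      by (simp add: T_def UN_least up_set_subset_ultrapower)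
    fix x :: "nat \<Rightarrow> 'a" assume x: "x \<in> UNIV \<rightarrow> space M"
    let ?c = "up_class U (space M) x"
    have T_iff: "?c \<in> T r \<longleftrightarrow> eventually (\<lambda>n. real_of_rat r < f n (x n)) U" for r
      using x by (simp add: T_def up_class_in_up_set_iff Pi_iff)
    have "a < up_lim U f ?c \<longleftrightarrow> (\<exists>r. a < ereal (real_of_rat r) \<and> ?c \<in> T r)"
    proof
      assume "a < up_lim U f ?c"
      then obtain r where r: "a < ereal (real_of_rat r)" "ereal (real_of_rat r) < up_lim U f ?c"
        using ereal_dense3 by blast
      have "eventually (\<lambda>n. ereal (real_of_rat r) < ereal (f n (x n))) U"
        using up_lim_tendsto[OF x] r(2) by (rule order_tendstoD)
      then show "\<exists>r. a < ereal (real_of_rat r) \<and> ?c \<in> T r"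
        using r(1) by (auto simp: T_iff)
    next
      assume "\<exists>r. a < ereal (real_of_rat r) \<and> ?c \<in> T r"
      then obtain r where r: "a < ereal (real_of_rat r)"
          and ev: "eventually (\<lambda>n. real_of_rat r < f n (x n)) U"
        by (auto simp: T_iff)
      \<comment> \<open>The limit preserves only the weak inequality; the gap between
        \<open>a\<close> and \<open>r\<close> restores strictness.\<close>
      have "eventually (\<lambda>n. ereal (real_of_rat r) \<le> ereal (f n (x n))) U"
        using ev by eventually_elim simp
      then have "ereal (real_of_rat r) \<le> up_lim U f ?c"
        using U_neq_bot by (rule tendsto_lowerbound[OF up_lim_tendsto[OF x]])
      with r show "a < up_lim U f ?c"
        by simp
    qed
    then show "?c \<in> up_lim U f -` {a<..} \<inter> space (ultrapower_measure U M) \<longleftrightarrow>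
        ?c \<in> (\<Union>r\<in>{r. a < ereal (real_of_rat r)}. T r)"
      using up_class_in_ultrapower[OF x] by (simp add: space_ultrapower_measure)
  qed
  also have "\<dots> \<in> sets (ultrapower_measure U M)"
    using T by (intro sets.countable_UN') (auto intro: countableI_type)
  finally show "up_lim U f -` {a<..} \<inter> space (ultrapower_measure U M) \<in> sets (ultrapower_measure U M)" .
qed

section \<open>Exchange of ultralimit and integral, first for staircases\<close>

text \<open>\<open>S\<close> is a finite combination of indicators of UP-sets of superlevel sets.
  Its integral therefore involves only measures of UP-sets, which are ultralimits of the measures of
  the factors.\<close>

lemma nn_integral_up_staircase:
  fixes h :: "nat \<Rightarrow> 'a \<Rightarrow> real"
  assumes h[measurable]: "\<And>n. h n \<in> borel_measurable M" and d: "0 \<le> d"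
  obtains S where "S \<in> borel_measurable (ultrapower_measure U M)"
    and "((\<lambda>n. \<integral>\<^sup>+x. ennreal (staircase d k (h n x)) \<partial>M)
      \<longlongrightarrow> (\<integral>\<^sup>+c. S c \<partial>ultrapower_measure U M)) U"
    and "\<forall>x\<in>UNIV \<rightarrow> space M.
      ((\<lambda>n. ennreal (staircase d k (h n (x n)))) \<longlongrightarrow> S (up_class U (space M) x)) U"
proof -
  define A where "A j n = {x \<in> space M. real (Suc j) * d \<le> h n x}" for j n
  have A[measurable]: "A j n \<in> events" for j n
    unfolding A_def by measurable
  define T where "T j = up_set U (space M) (A j)" for j
  have T[measurable]: "T j \<in> sets (ultrapower_measure U M)" for j
    unfolding T_def by (rule sets_ultrapower_measure_up_set[OF A])
  define S :: "(nat \<Rightarrow> 'a) set \<Rightarrow> ennreal" where "S c = (\<Sum>j<k. ennreal d * indicator (T j) c)" for c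
  have stair: "ennreal (staircase d k (h n x)) = (\<Sum>j<k. ennreal d * indicator (A j n) x)"
    if "x \<in> space M" for n x
  proof -
    have "ennreal (staircase d k (h n x)) = (\<Sum>j<k. ennreal (if real (Suc j) * d \<le> h n x then d else 0))"
      unfolding staircase_def using d by (subst sum_ennreal) auto
    also have "\<dots> = (\<Sum>j<k. ennreal d * indicator (A j n) x)"
      using that by (intro sum.cong) (auto simp: A_def)
    finally show ?thesis .
  qed
  have "((\<lambda>n. \<Sum>j<k. ennreal d * emeasure M (A j n))
      \<longlongrightarrow> (\<Sum>j<k. ennreal d * emeasure (ultrapower_measure U M) (T j))) U"
    unfolding T_def by (intro tendsto_sum ennreal_tendsto_cmult emeasure_up_set_tendsto A) simp
  moreover have "(\<Sum>j<k. ennreal d * emeasure M (A j n)) = (\<integral>\<^sup>+x. ennreal (staircase d k (h n x)) \<partial>M)" for n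
  proof -
    have "(\<integral>\<^sup>+x. ennreal (staircase d k (h n x)) \<partial>M)
        = (\<integral>\<^sup>+x. (\<Sum>j<k. ennreal d * indicator (A j n) x) \<partial>M)"
      by (rule nn_integral_cong) (rule stair)
    also have "\<dots> = (\<Sum>j<k. ennreal d * emeasure M (A j n))"
      by (subst nn_integral_sum) (simp_all add: nn_integral_cmult_indicator)
    finally show ?thesis ..
  qed
  moreover have "(\<Sum>j<k. ennreal d * emeasure (ultrapower_measure U M) (T j))
      = (\<integral>\<^sup>+c. S c \<partial>ultrapower_measure U M)"
    unfolding S_def by (subst nn_integral_sum) (simp_all add: nn_integral_cmult_indicator)
  ultimately have "((\<lambda>n. \<integral>\<^sup>+x. ennreal (staircase d k (h n x)) \<partial>M)
      \<longlongrightarrow> (\<integral>\<^sup>+c. S c \<partial>ultrapower_measure U M)) U"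
    by simp
  moreover have "((\<lambda>n. ennreal (staircase d k (h n (x n)))) \<longlongrightarrow> S (up_class U (space M) x)) U"
    if x: "x \<in> UNIV \<rightarrow> space M" for x
  proof (rule tendsto_eventually)
    \<comment> \<open>By the ultrafilter dichotomy, membership at level \<open>j\<close> agrees with
      membership of the class in \<open>T j\<close> for U-almost all \<open>n\<close>. There are
      finitely many levels, so all agree simultaneously and the staircase values are eventually
      equal to their limit.\<close>
    have "eventually (\<lambda>n. x n \<in> A j n \<longleftrightarrow> up_class U (space M) x \<in> T j) U" for j
    proof (cases "eventually (\<lambda>n. x n \<in> A j n) U")
      case True
      then show ?thesis
        by (simp add: T_def up_class_in_up_set_iff[OF x])
    next
      case False
      then have "eventually (\<lambda>n. x n \<notin> A j n) U"
        using ultrafilter_not_eventually[OF ultrafilter] by blast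
      with False show ?thesis
        by (simp add: T_def up_class_in_up_set_iff[OF x])
    qed
    then have "eventually (\<lambda>n. \<forall>j\<in>{..<k}. x n \<in> A j n \<longleftrightarrow> up_class U (space M) x \<in> T j) U"
      by (simp add: eventually_ball_finite_distrib)
    then show "eventually (\<lambda>n. ennreal (staircase d k (h n (x n))) = S (up_class U (space M) x)) U"
    proof eventually_elim
      case (elim n)
      have "x n \<in> space M"
        using x by auto
      with elim show ?case
        unfolding stair[OF \<open>x n \<in> space M\<close>] S_def by (intro sum.cong) (auto split: split_indicator)
    qed
  qed
  moreover have "S \<in> borel_measurable (ultrapower_measure U M)"
    unfolding S_def by measurable
  ultimately show thesis
    using that by blast
qed

text \<open>The limit function is an arbitrary measurable \<open>H\<close> with values in
  \<open>ennreal\<close>, so that the result applies to the positive and to the negative part of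
  \<open>up_lim U f\<close>.\<close>

lemma nn_integral_ultralimit:
  fixes h :: "nat \<Rightarrow> 'a \<Rightarrow> real"
  assumes g: "integrable M g"
    and h[measurable]: "\<And>n. h n \<in> borel_measurable M"
    and nonneg: "\<And>n x. x \<in> space M \<Longrightarrow> 0 \<le> h n x"
    and bound: "\<And>n x. x \<in> space M \<Longrightarrow> h n x \<le> g x"
    and H[measurable]: "H \<in> borel_measurable (ultrapower_measure U M)"
    and lim: "\<And>x. x \<in> UNIV \<rightarrow> space M \<Longrightarrow>
      ((\<lambda>n. ennreal (h n (x n))) \<longlongrightarrow> H (up_class U (space M) x)) U"
  shows "((\<lambda>n. \<integral>\<^sup>+x. ennreal (h n x) \<partial>M) \<longlongrightarrow> (\<integral>\<^sup>+c. H c \<partial>ultrapower_measure U M)) U"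
proof -
  let ?N = "ultrapower_measure U M"
  interpret N: prob_space ?N
    by (rule prob_space_ultrapower_measure)
  have g_meas[measurable]: "g \<in> borel_measurable M"
    using g by auto
  define L where "L = Lim U (\<lambda>n. \<integral>\<^sup>+x. ennreal (h n x) \<partial>M)"
  have L: "((\<lambda>n. \<integral>\<^sup>+x. ennreal (h n x) \<partial>M) \<longlongrightarrow> L) U"
    unfolding L_def by (rule tendsto_Lim_ultrafilter_linorder[OF ultrafilter])
  \<comment> \<open>\<open>ennreal\<close> sends negative numbers to 0, so \<open>R t\<close> is the
    integral of the positive part of \<open>g - t\<close>.\<close>
  define R where "R t = (\<integral>\<^sup>+x. ennreal (g x - t) \<partial>M)" for t :: real
  \<comment> \<open>Both estimates compare with the integral of the limiting staircase
    \<open>S\<close>. In the first, \<open>H\<close> is truncated because the staircase stops at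
    \<open>k * d\<close>; in the second, \<open>R\<close> pays for the part of \<open>h n\<close>
    above that height, uniformly in \<open>n\<close>.\<close>
  have bounds: "(\<integral>\<^sup>+c. min (H c) (ennreal (real k * d)) \<partial>?N) \<le> L + ennreal d"
      "L \<le> (\<integral>\<^sup>+c. H c \<partial>?N) + ennreal d + R (real k * d)" if d: "0 \<le> d" for d k
  proof -
    obtain S where S[measurable]: "S \<in> borel_measurable ?N"
      and S_int: "((\<lambda>n. \<integral>\<^sup>+x. ennreal (staircase d k (h n x)) \<partial>M) \<longlongrightarrow> (\<integral>\<^sup>+c. S c \<partial>?N)) U"
      and S_lim: "\<forall>x\<in>UNIV \<rightarrow> space M.
        ((\<lambda>n. ennreal (staircase d k (h n (x n)))) \<longlongrightarrow> S (up_class U (space M) x)) U"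
      by (rule nn_integral_up_staircase[where h = h and k = k, OF h d])
    note S_lim = S_lim[rule_format]
    have stair_meas[measurable]: "(\<lambda>x. staircase d k (h n x)) \<in> borel_measurable M" for n
      unfolding staircase_def by measurable
    have stair: "ennreal (staircase d k (h n x)) \<le> ennreal (h n x)"
        "ennreal (min (h n x) (real k * d)) \<le> ennreal (staircase d k (h n x)) + ennreal d"
        "ennreal (h n x) \<le> ennreal (staircase d k (h n x)) + ennreal d + ennreal (g x - real k * d)"
      if x: "x \<in> space M" for n x
    proof -
      note st = staircase_approx[OF d nonneg[OF x, of n], of k]
      have st0: "0 \<le> staircase d k (h n x)"
        using d by (auto simp: staircase_def intro!: sum_nonneg)
      show "ennreal (staircase d k (h n x)) \<le> ennreal (h n x)"
        using st(1) by (rule ennreal_leI)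
      show 2: "ennreal (min (h n x) (real k * d)) \<le> ennreal (staircase d k (h n x)) + ennreal d"
        using st(2) st0 d by (simp add: ennreal_leI flip: ennreal_plus)
      \<comment> \<open>Domination enters here: the excess of \<open>h n\<close> over
        \<open>k * d\<close> is at most that of \<open>g\<close>.\<close>
      have "ennreal (h n x) \<le> ennreal (min (h n x) (real k * d) + max 0 (g x - real k * d))"
        using bound[OF x, of n] by (intro ennreal_leI) (auto simp: min_def max_def)
      also have "\<dots> = ennreal (min (h n x) (real k * d)) + ennreal (max 0 (g x - real k * d))"
        using nonneg[OF x, of n] d by (intro ennreal_plus) auto
      also have "ennreal (max 0 (g x - real k * d)) = ennreal (g x - real k * d)"
        by (auto simp: max_def ennreal_neg)
      finally show "ennreal (h n x) \<le> ennreal (staircase d k (h n x)) + ennreal d + ennreal (g x - real k * d)"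
        using 2 by (meson add_right_mono order_trans)
    qed
    have SL: "(\<integral>\<^sup>+c. S c \<partial>?N) \<le> L"
      by (rule tendsto_le[OF U_neq_bot L S_int]) (intro always_eventually allI nn_integral_mono stair)
    have SH: "S c \<le> H c" if "c \<in> space ?N" for c
    proof -
      obtain x where x: "x \<in> UNIV \<rightarrow> space M" and c: "c = up_class U (space M) x"
        using \<open>c \<in> space ?N\<close> unfolding space_ultrapower_measure by (rule ultrapower_cases)
      have xn: "x n \<in> space M" for n
        using x by auto
      show ?thesis
        unfolding c
        by (rule tendsto_le[OF U_neq_bot lim[OF x] S_lim[OF x]])
          (intro always_eventually allI stair xn)
    qed
    have HS: "min (H c) (ennreal (real k * d)) \<le> S c + ennreal d" if "c \<in> space ?N" for c
    proof -
      obtain x where x: "x \<in> UNIV \<rightarrow> space M" and c: "c = up_class U (space M) x"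
        using \<open>c \<in> space ?N\<close> unfolding space_ultrapower_measure by (rule ultrapower_cases)
      have xn: "x n \<in> space M" for n
        using x by auto
      have "((\<lambda>n. min (ennreal (h n (x n))) (ennreal (real k * d))) \<longlongrightarrow> min (H c) (ennreal (real k * d))) U"
        unfolding c by (intro tendsto_min lim[OF x] tendsto_const)
      moreover have "((\<lambda>n. ennreal (staircase d k (h n (x n))) + ennreal d) \<longlongrightarrow> S c + ennreal d) U"
        unfolding c by (intro tendsto_add S_lim[OF x] tendsto_const)
      moreover have "min (ennreal (h n (x n))) (ennreal (real k * d))
          \<le> ennreal (staircase d k (h n (x n))) + ennreal d" for n
        using stair(2)[OF xn, of n n] by (auto simp: min_def ennreal_leI split: if_splits intro: order_trans)
      ultimately show ?thesis
        by (intro tendsto_le[OF U_neq_bot]) (auto intro!: always_eventually)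
    qed
    have "(\<integral>\<^sup>+c. min (H c) (ennreal (real k * d)) \<partial>?N) \<le> (\<integral>\<^sup>+c. S c + ennreal d \<partial>?N)"
      by (intro nn_integral_mono HS)
    \<comment> \<open>The ultrapower has mass 1, so the pointwise error \<open>d\<close> integrates
      to \<open>d\<close>.\<close>
    also have "\<dots> = (\<integral>\<^sup>+c. S c \<partial>?N) + ennreal d"
      by (subst nn_integral_add) (simp_all add: N.emeasure_space_1)
    also have "\<dots> \<le> L + ennreal d"
      using SL by (rule add_right_mono)
    finally show "(\<integral>\<^sup>+c. min (H c) (ennreal (real k * d)) \<partial>?N) \<le> L + ennreal d" .
    have "(\<integral>\<^sup>+x. ennreal (h n x) \<partial>M)
        \<le> (\<integral>\<^sup>+x. ennreal (staircase d k (h n x)) \<partial>M) + ennreal d + R (real k * d)" for n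
    proof -
      have "(\<integral>\<^sup>+x. ennreal (h n x) \<partial>M)
          \<le> (\<integral>\<^sup>+x. ennreal (staircase d k (h n x)) + ennreal d + ennreal (g x - real k * d) \<partial>M)"
        by (intro nn_integral_mono stair)
      also have "\<dots> = (\<integral>\<^sup>+x. ennreal (staircase d k (h n x)) \<partial>M) + ennreal d + R (real k * d)"
        unfolding R_def by (subst nn_integral_add, simp, simp, subst nn_integral_add)
          (simp_all add: emeasure_space_1)
      finally show ?thesis .
    qed
    then have "eventually (\<lambda>n. (\<integral>\<^sup>+x. ennreal (h n x) \<partial>M)
        \<le> (\<integral>\<^sup>+x. ennreal (staircase d k (h n x)) \<partial>M) + ennreal d + R (real k * d)) U"
      by simp
    then have "L \<le> (\<integral>\<^sup>+c. S c \<partial>?N) + ennreal d + R (real k * d)"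
      by (rule tendsto_le[OF U_neq_bot _ L, rotated]) (intro tendsto_add tendsto_const S_int)
    also have "\<dots> \<le> (\<integral>\<^sup>+c. H c \<partial>?N) + ennreal d + R (real k * d)"
      by (intro add_right_mono nn_integral_mono SH)
    finally show "L \<le> (\<integral>\<^sup>+c. H c \<partial>?N) + ennreal d + R (real k * d)" .
  qed
  \<comment> \<open>Mesh \<open>1 / (m + 1)\<close> with \<open>(m + 1)^2\<close> steps reaches
    height \<open>m + 1\<close>: the mesh shrinks while the cap grows.\<close>
  define d where "d m = 1 / real (Suc m)" for m
  have d: "real (Suc m * Suc m) * d m = real (Suc m)" "0 \<le> d m" for m
    unfolding of_nat_mult d_def by (simp_all del: of_nat_Suc)
  have upper: "(\<integral>\<^sup>+c. min (H c) (ennreal (real (Suc m))) \<partial>?N) \<le> L + ennreal (d m)" for m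
    using bounds(1)[OF d(2)[of m], of "Suc m * Suc m"] unfolding d(1) .
  have lower: "L \<le> (\<integral>\<^sup>+c. H c \<partial>?N) + ennreal (d m) + R (real (Suc m))" for m
    using bounds(2)[OF d(2)[of m], of "Suc m * Suc m"] unfolding d(1) .
  have d_lim: "(\<lambda>m. ennreal (d m)) \<longlonglongrightarrow> 0"
    using tendsto_ennrealI[OF LIMSEQ_Suc[OF lim_1_over_n]] by (simp add: d_def)
  \<comment> \<open>Dominated convergence with majorant \<open>g\<close>: at each point the
    integrand vanishes once \<open>m\<close> is large.\<close>
  have R_lim: "(\<lambda>m. R (real (Suc m))) \<longlonglongrightarrow> 0"
  proof -
    have "(\<lambda>m. \<integral>\<^sup>+x. ennreal (g x - real (Suc m)) \<partial>M) \<longlonglongrightarrow> (\<integral>\<^sup>+x. 0 \<partial>M)"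
    proof (rule nn_integral_dominated_convergence[where w = "\<lambda>x. ennreal (g x)"])
      show "AE x in M. (\<lambda>m. ennreal (g x - real (Suc m))) \<longlonglongrightarrow> 0"
      proof (rule AE_I2, rule tendsto_eventually)
        fix x
        obtain k where "g x \<le> real k"
          using real_arch_simple by blast
        then show "eventually (\<lambda>m. ennreal (g x - real (Suc m)) = 0) sequentially"
          by (intro eventually_sequentiallyI[of k]) (simp add: ennreal_neg)
      qed
      show "(\<integral>\<^sup>+x. ennreal (g x) \<partial>M) < \<infinity>"
        using integrableD(2)[OF g] by (simp add: less_top)
    qed (auto intro!: ennreal_leI)
    then show ?thesis
      by (simp add: R_def)
  qed
  \<comment> \<open>Monotone convergence for the truncations of \<open>H\<close>; their supremum is
    \<open>H\<close> also where \<open>H\<close> is infinite.\<close>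
  have H_lim: "(\<lambda>m. \<integral>\<^sup>+c. min (H c) (ennreal (real (Suc m))) \<partial>?N) \<longlonglongrightarrow> (\<integral>\<^sup>+c. H c \<partial>?N)"
  proof -
    have "min a (ennreal (real (Suc m))) \<le> min a (ennreal (real (Suc n)))" if "m \<le> n" for a m n
      using that by (intro min.mono order_refl ennreal_leI) simp
    then have inc: "incseq (\<lambda>m c. min (H c) (ennreal (real (Suc m))))"
      by (simp add: incseq_def le_fun_def)
    have "(SUP m. min a (ennreal (real (Suc m)))) = a" for a
    proof (rule LIMSEQ_unique[OF LIMSEQ_SUP])
      show "incseq (\<lambda>m. min a (ennreal (real (Suc m))))"
        by (intro monoI min.mono order_refl ennreal_leI) simp
      have "(\<lambda>m. min a (ennreal (real (Suc m)))) \<longlonglongrightarrow> min a top"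
        using LIMSEQ_Suc[OF of_nat_tendsto_top_ennreal]
        by (intro tendsto_min tendsto_const) (simp add: ennreal_of_nat_eq_real_of_nat)
      then show "(\<lambda>m. min a (ennreal (real (Suc m)))) \<longlonglongrightarrow> a"
        by simp
    qed
    then have "(\<integral>\<^sup>+c. H c \<partial>?N) = (SUP m. \<integral>\<^sup>+c. min (H c) (ennreal (real (Suc m))) \<partial>?N)"
      using nn_integral_monotone_convergence_SUP[OF inc, of ?N] by simp
    moreover have "incseq (\<lambda>m. \<integral>\<^sup>+c. min (H c) (ennreal (real (Suc m))) \<partial>?N)"
      by (intro monoI nn_integral_mono min.mono order_refl ennreal_leI) simp
    ultimately show ?thesis
      by (simp add: LIMSEQ_SUP)
  qed
  have "(\<integral>\<^sup>+c. H c \<partial>?N) \<le> L + 0"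
  proof (rule LIMSEQ_le[OF H_lim])
    show "(\<lambda>m. L + ennreal (d m)) \<longlonglongrightarrow> L + 0"
      by (intro tendsto_add tendsto_const d_lim)
    show "\<exists>N. \<forall>m\<ge>N. (\<integral>\<^sup>+c. min (H c) (ennreal (real (Suc m))) \<partial>?N) \<le> L + ennreal (d m)"
      using upper by blast
  qed
  moreover have "L \<le> (\<integral>\<^sup>+c. H c \<partial>?N) + 0 + 0"
  proof (rule LIMSEQ_le_const)
    show "(\<lambda>m. (\<integral>\<^sup>+c. H c \<partial>?N) + ennreal (d m) + R (real (Suc m))) \<longlonglongrightarrow> (\<integral>\<^sup>+c. H c \<partial>?N) + 0 + 0"
      by (intro tendsto_add tendsto_const d_lim R_lim)
    show "\<exists>N. \<forall>m\<ge>N. L \<le> (\<integral>\<^sup>+c. H c \<partial>?N) + ennreal (d m) + R (real (Suc m))"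
      using lower by blast
  qed
  ultimately have "L = (\<integral>\<^sup>+c. H c \<partial>?N)"
    by simp
  with L show ?thesis
    by simp
qed

end

section \<open>Signed functions: positive and negative parts of the ultralimit\<close>

theorem theorem1:
  fixes X :: "'a::metric_space set" and M :: "'a measure" and U :: "nat filter"
    and g :: "'a \<Rightarrow> real" and f :: "nat \<Rightarrow> 'a \<Rightarrow> real"
  assumes "compact X"
    and "prob_space M" and "sets M = sets (restrict_space borel X)"
    and "nonprincipal_ultrafilter U"
    and "integrable M g" and "\<And>n. integrable M (f n)"
    and "\<And>n x. x \<in> X \<Longrightarrow> \<bar>f n x\<bar> \<le> g x"
  shows "ereal_integrable (ultrapower_measure U M) (up_lim U f)
    \<and> ereal_integral (ultrapower_measure U M) (up_lim U f) = Lim U (\<lambda>n. ereal (\<integral>x. f n x \<partial>M))"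
proof -
  interpret prob_space M by fact
  interpret ultrapower_prob_space M U
    by unfold_locales fact
  let ?N = "ultrapower_measure U M" and ?F = "up_lim U f"
  have sp: "space M = X"
    using sets_eq_imp_space_eq[OF assms(3)] by (simp add: space_restrict_space)
  note f = assms(6)
  have f_meas[measurable]: "f n \<in> borel_measurable M" for n
    using f by auto
  have F_meas[measurable]: "?F \<in> borel_measurable ?N"
    by (rule up_lim_measurable) measurable
  \<comment> \<open>The nonnegative case is applied to \<open>max 0 (f n x)\<close> and
    \<open>max 0 (- f n x)\<close>; since \<open>ennreal\<close> truncates at 0, the maxima
    disappear afterwards.\<close>
  have max0: "ennreal (max 0 r) = ennreal r" for r
    by (auto simp: max_def ennreal_neg)
  have g_fin: "(\<integral>\<^sup>+x. ennreal (g x) \<partial>M) < \<infinity>"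
    using integrableD(2)[OF assms(5)] by (simp add: less_top)
  have pos: "((\<lambda>n. \<integral>\<^sup>+x. ennreal (f n x) \<partial>M) \<longlongrightarrow> (\<integral>\<^sup>+c. e2ennreal (?F c) \<partial>?N)) U"
  proof -
    have "((\<lambda>n. \<integral>\<^sup>+x. ennreal (max 0 (f n x)) \<partial>M) \<longlongrightarrow> (\<integral>\<^sup>+c. e2ennreal (?F c) \<partial>?N)) U"
    proof (rule nn_integral_ultralimit[OF assms(5)])
      show "max 0 (f n x) \<le> g x" if "x \<in> space M" for n x
        using assms(7)[of x n] that by (auto simp: sp)
      show "((\<lambda>n. ennreal (max 0 (f n (x n)))) \<longlongrightarrow> e2ennreal (?F (up_class U (space M) x))) U"
        if "x \<in> UNIV \<rightarrow> space M" for x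
        using tendsto_e2ennrealI[OF up_lim_tendsto[OF that]] by (simp add: max0)
    qed simp_all
    then show ?thesis
      by (simp add: max0)
  qed
  have neg: "((\<lambda>n. \<integral>\<^sup>+x. ennreal (- f n x) \<partial>M) \<longlongrightarrow> (\<integral>\<^sup>+c. e2ennreal (- ?F c) \<partial>?N)) U"
  proof -
    have "((\<lambda>n. \<integral>\<^sup>+x. ennreal (max 0 (- f n x)) \<partial>M) \<longlongrightarrow> (\<integral>\<^sup>+c. e2ennreal (- ?F c) \<partial>?N)) U"
    proof (rule nn_integral_ultralimit[OF assms(5)])
      show "max 0 (- f n x) \<le> g x" if "x \<in> space M" for n x
        using assms(7)[of x n] that by (auto simp: sp)
      show "((\<lambda>n. ennreal (max 0 (- f n (x n)))) \<longlongrightarrow> e2ennreal (- ?F (up_class U (space M) x))) U"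
        if "x \<in> UNIV \<rightarrow> space M" for x
        using tendsto_e2ennrealI[OF tendsto_uminus_ereal[OF up_lim_tendsto[OF that]]] by (simp add: max0)
    qed simp_all
    then show ?thesis
      by (simp add: max0)
  qed
  \<comment> \<open>The integral of \<open>g\<close> bounds both parts uniformly in
    \<open>n\<close>, hence also their limits, which makes both parts of the ultralimit
    finite.\<close>
  have "(\<integral>\<^sup>+x. ennreal (f n x) \<partial>M) \<le> (\<integral>\<^sup>+x. ennreal (g x) \<partial>M)"
      "(\<integral>\<^sup>+x. ennreal (- f n x) \<partial>M) \<le> (\<integral>\<^sup>+x. ennreal (g x) \<partial>M)" for n
    using assms(7)[of _ n] by (intro nn_integral_mono ennreal_leI; fastforce simp: sp abs_le_iff)+
  then have "(\<integral>\<^sup>+c. e2ennreal (?F c) \<partial>?N) \<le> (\<integral>\<^sup>+x. ennreal (g x) \<partial>M)"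
      "(\<integral>\<^sup>+c. e2ennreal (- ?F c) \<partial>?N) \<le> (\<integral>\<^sup>+x. ennreal (g x) \<partial>M)"
    by (auto intro!: tendsto_upperbound[OF pos _ U_neq_bot] tendsto_upperbound[OF neg _ U_neq_bot])
  with g_fin have fin: "(\<integral>\<^sup>+c. e2ennreal (?F c) \<partial>?N) < \<infinity>" "(\<integral>\<^sup>+c. e2ennreal (- ?F c) \<partial>?N) < \<infinity>"
    by (auto elim: le_less_trans)
  \<comment> \<open>The summands on the right are the positive and negative parts of
    \<open>a\<close>, so finiteness of their integrals gives integrability.\<close>
  have "e2ennreal \<bar>a\<bar> \<le> e2ennreal a + e2ennreal (- a)" for a
    by (cases a rule: ereal_cases) (auto simp: abs_if)
  then have "(\<integral>\<^sup>+c. e2ennreal \<bar>?F c\<bar> \<partial>?N) \<le> (\<integral>\<^sup>+c. e2ennreal (?F c) + e2ennreal (- ?F c) \<partial>?N)"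
    by (intro nn_integral_mono)
  also have "\<dots> = (\<integral>\<^sup>+c. e2ennreal (?F c) \<partial>?N) + (\<integral>\<^sup>+c. e2ennreal (- ?F c) \<partial>?N)"
    by (rule nn_integral_add) simp_all
  also have "\<dots> < \<infinity>"
    using fin by simp
  finally have "ereal_integrable ?N ?F"
    by (simp add: ereal_integrable_def)
  moreover have "ereal_integral ?N ?F = Lim U (\<lambda>n. ereal (\<integral>x. f n x \<partial>M))"
  proof -
    have "ereal (\<integral>x. f n x \<partial>M)
        = enn2ereal (\<integral>\<^sup>+x. ennreal (f n x) \<partial>M) - enn2ereal (\<integral>\<^sup>+x. ennreal (- f n x) \<partial>M)" for n
      using f[of n] by (elim integrableE) simp
    \<comment> \<open>Subtraction on \<open>ereal\<close> is continuous away from infinity minus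
      infinity, which the finiteness of both parts excludes.\<close>
    moreover have "((\<lambda>n. enn2ereal (\<integral>\<^sup>+x. ennreal (f n x) \<partial>M) - enn2ereal (\<integral>\<^sup>+x. ennreal (- f n x) \<partial>M))
        \<longlongrightarrow> ereal_integral ?N ?F) U"
      unfolding ereal_integral_def
      using fin by (intro tendsto_diff_ereal tendsto_enn2erealI pos neg) (auto simp: less_top)
    ultimately have "((\<lambda>n. ereal (\<integral>x. f n x \<partial>M)) \<longlongrightarrow> ereal_integral ?N ?F) U"
      by simp
    then show ?thesis
      using tendsto_Lim[OF U_neq_bot] by metis
  qed
  ultimately show ?thesis ..
qed

end
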